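(* Let $S$ and $R$ be rings and let $f:S\rightarrow R$ be a (not necessarily unitary) ring homomorphism with $f[S]\subseteq Z(R)$. Then $f$ satisfies GU if and only if for every nonempty chain $\mathcal D\subseteq\mathrm{Spec}(S)$ and for every nonempty maximal $\mathcal D$-chain $\mathcal C\subseteq\mathrm{Spec}(R)$ the following holds: for every $P\in\mathcal D$ there exists $Q\in\mathcal C$ such that $P\subseteq f^{-1}[Q]$.
   Context: Rings are nontrivial, associative, with identity, not necessarily commutative; homomorphisms need not send $1$ to $1$. $Z(R)$ is the center of $R$. $\mathrm{Spec}$ denotes the set of prime (two-sided, proper) ideals: $P$ is prime if $aRb\subseteq P$ implies $a\in P$ or $b\in P$. $\subset$ means proper inclusion. All chains are with respect to containment. An ideal $Q$ of $R$ lies over an ideal $P$ of $S$ if $f^{-1}[Q]=P$. (For $Q\in\mathrm{Spec}(R)$, $f^{-1}[Q]$ is either a prime ideal of $S$ or equal to $S$.) GU: for any $P_1\subset P_2$ in $\mathrm{Spec}(S)$ and every $Q_1\in\mathrm{Spec}(R)$ lying over $P_1$, there is $Q_2\in\mathrm{Spec}(R)$ with $Q_1\subset Q_2$ lying over $P_2$. For a chain $\mathcal D\subseteq\mathrm{Spec}(S)$, a $\mathcal D$-chain is a chain $\mathcal C\subseteq\mathrm{Spec}(R)$ with $f^{-1}[Q]\in\mathcal D$ for every $Q\in\mathcal C$. A maximal $\mathcal D$-chain is a $\mathcal D$-chain that is maximal, with respect to containment, among $\mathcal D$-chains. *)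

theory Defs
  imports "HOL-Algebra.Ideal"
begin

text \<open>
  Rings are HOL-Algebra rings (associative, with identity, possibly noncommutative). The locale
  \<open>ring\<close> admits the zero ring, which is excluded here.
\<close>
locale nontrivial_ring = ring +
  assumes one_not_zero: "\<one> \<noteq> \<zero>"

definition ring_center :: "('a, 'm) ring_scheme \<Rightarrow> 'a set"
  where "ring_center R = {z \<in> carrier R. \<forall>r \<in> carrier R. z \<otimes>\<^bsub>R\<^esub> r = r \<otimes>\<^bsub>R\<^esub> z}"

text \<open>Unlike \<^const>\<open>ring_hom\<close>, no preservation of \<open>\<one>\<close> is required.\<close>
definition nonunital_ring_hom ::
  "('a, 'm) ring_scheme \<Rightarrow> ('b, 'n) ring_scheme \<Rightarrow> ('a \<Rightarrow> 'b) set"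
  where "nonunital_ring_hom S R =
    {h. h \<in> carrier S \<rightarrow> carrier R \<and>
        (\<forall>x \<in> carrier S. \<forall>y \<in> carrier S.
           h (x \<oplus>\<^bsub>S\<^esub> y) = h x \<oplus>\<^bsub>R\<^esub> h y \<and> h (x \<otimes>\<^bsub>S\<^esub> y) = h x \<otimes>\<^bsub>R\<^esub> h y)}"

text \<open>
  The library's \<^locale>\<open>primeideal\<close> presupposes a commutative ring and is defined elementwise
  (\<open>a b \<in> P\<close>); here primeness is the noncommutative condition \<open>a R b \<subseteq> P\<close>.
\<close>
definition Spec :: "('a, 'm) ring_scheme \<Rightarrow> 'a set set"
  where "Spec R =
    {P. ideal P R \<and> P \<noteq> carrier R \<and>
        (\<forall>a \<in> carrier R. \<forall>b \<in> carrier R.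
           {a \<otimes>\<^bsub>R\<^esub> r \<otimes>\<^bsub>R\<^esub> b | r. r \<in> carrier R} \<subseteq> P \<longrightarrow> a \<in> P \<or> b \<in> P)}"

definition contraction :: "('a, 'm) ring_scheme \<Rightarrow> ('a \<Rightarrow> 'b) \<Rightarrow> 'b set \<Rightarrow> 'a set"
  where "contraction S f Q = f -` Q \<inter> carrier S"

definition lies_over :: "('a, 'm) ring_scheme \<Rightarrow> ('a \<Rightarrow> 'b) \<Rightarrow> 'b set \<Rightarrow> 'a set \<Rightarrow> bool"
  where "lies_over S f Q P \<longleftrightarrow> contraction S f Q = P"

definition GU :: "('a, 'm) ring_scheme \<Rightarrow> ('b, 'n) ring_scheme \<Rightarrow> ('a \<Rightarrow> 'b) \<Rightarrow> bool"
  where "GU S R f \<longleftrightarrow>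
    (\<forall>P1 \<in> Spec S. \<forall>P2 \<in> Spec S. P1 \<subset> P2 \<longrightarrow>
       (\<forall>Q1 \<in> Spec R. lies_over S f Q1 P1 \<longrightarrow>
          (\<exists>Q2 \<in> Spec R. Q1 \<subset> Q2 \<and> lies_over S f Q2 P2)))"

text \<open>
  \<open>subset.chain A C\<close> (theory Zorn) says that \<open>C \<subseteq> A\<close> and any two members of \<open>C\<close> are comparable
  under \<open>\<subseteq>\<close>. The empty set is a chain.
\<close>
definition D_chain ::
  "('a, 'm) ring_scheme \<Rightarrow> ('b, 'n) ring_scheme \<Rightarrow> ('a \<Rightarrow> 'b) \<Rightarrow> 'a set set \<Rightarrow> 'b set set \<Rightarrow> bool"
  where "D_chain S R f D C \<longleftrightarrow> subset.chain (Spec R) C \<and> (\<forall>Q \<in> C. contraction S f Q \<in> D)"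

definition maximal_D_chain ::
  "('a, 'm) ring_scheme \<Rightarrow> ('b, 'n) ring_scheme \<Rightarrow> ('a \<Rightarrow> 'b) \<Rightarrow> 'a set set \<Rightarrow> 'b set set \<Rightarrow> bool"
  where "maximal_D_chain S R f D C \<longleftrightarrow>
    D_chain S R f D C \<and> (\<nexists>C'. D_chain S R f D C' \<and> C \<subset> C')"

end

theory Submission
  imports Defs "HOL-Algebra.Ring_Divisibility"
begin

text \<open>
  For the forward direction, suppose that \<open>P \<in> D\<close> is contained in no contraction of a member of \<open>C\<close>.
  As \<open>D\<close> is a chain, all these contractions lie in \<open>P\<close>, so \<open>U = \<Union>C\<close> is an ideal whose
  contraction \<open>P\<^sub>0\<close> lies in \<open>P\<close>. In a noncommutative ring \<open>U\<close> need not be prime. But \<open>f[S]\<close> is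
  central, so contractions of primes are completely prime, and hence so is \<open>P\<^sub>0\<close>; an ideal that
  contains \<open>U\<close> and is maximal with respect to being disjoint from the multiplicative set \<open>f[S - P\<^sub>0]\<close>
  is then a prime over \<open>P\<^sub>0\<close>. Going up from it yields a prime over \<open>P\<close> that contains all members of
  \<open>C\<close>, against the maximality of \<open>C\<close>. Conversely, given \<open>P\<^sub>1 \<subset> P\<^sub>2\<close> and \<open>Q\<^sub>1\<close> over \<open>P\<^sub>1\<close>, a maximal
  \<open>{P\<^sub>1, P\<^sub>2}\<close>-chain through \<open>Q\<^sub>1\<close> contains a prime over \<open>P\<^sub>2\<close>.
\<close>

section \<open>Maximal chains through a given chain\<close>

text \<open>Zorn's lemma applied to the chains that contain \<open>B\<close>, ordered by inclusion.
  The converse direction needs a maximal chain through a prescribed prime, not just some maximal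
  chain.\<close>

lemma subset_maxchain_extends:
  assumes "subset.chain A B"
  obtains C where "subset.maxchain A C" "B \<subseteq> C"
proof -
  define F where "F = {C. subset.chain A C \<and> B \<subseteq> C}"
  have "\<exists>U\<in>F. \<forall>X\<in>K. X \<subseteq> U" if K: "subset.chain F K" for K
  proof (cases "K = {}")
    \<comment> \<open>The empty union need not contain \<open>B\<close>, so here the upper bound is
      \<open>B\<close> itself.\<close>
    case True
    then show ?thesis using assms unfolding F_def by blast
  next
    case False
    have mem: "k \<subseteq> A" "B \<subseteq> k" "\<And>X Y. X \<in> k \<Longrightarrow> Y \<in> k \<Longrightarrow> X \<subseteq> Y \<or> Y \<subseteq> X"
      if "k \<in> K" for k
      using K that by (auto simp: F_def subset_chain_def)
    have "X \<subseteq> Y \<or> Y \<subseteq> X" if XY: "X \<in> \<Union>K" "Y \<in> \<Union>K" for X Y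
    proof -
      obtain k l where kl: "k \<in> K" "l \<in> K" "X \<in> k" "Y \<in> l" using XY by auto
      then have "k \<subseteq> l \<or> l \<subseteq> k" using K by (simp add: subset_chain_def)
      then obtain m where "m \<in> K" "X \<in> m" "Y \<in> m" using kl by auto
      then show ?thesis by (rule mem(3))
    qed
    then have "subset.chain A (\<Union>K)"
      unfolding subset_chain_def using Union_least[OF mem(1)] by (intro conjI ballI)
    moreover have "B \<subseteq> \<Union>K" using mem(2) False by auto
    ultimately have "\<Union>K \<in> F" by (simp add: F_def)
    then show ?thesis by auto
  qed
  from subset_Zorn[of F, OF this]
  obtain C where C: "C \<in> F" "\<And>X. X \<in> F \<Longrightarrow> C \<subseteq> X \<Longrightarrow> X = C"
    by auto
  have chain: "subset.chain A C" and B: "B \<subseteq> C" using C(1) by (simp_all add: F_def)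
  have "\<not> C \<subset> X" if "subset.chain A X" for X
    using C(2)[of X] B that by (auto simp: F_def)
  with chain have "subset.maxchain A C" by (simp add: subset.maxchain_def)
  then show thesis using B by (rule that)
qed

section \<open>Prime ideals that avoid a multiplicative set\<close>

context ring
begin

lemma idealI_closed:
  assumes sub: "J \<subseteq> carrier R" and zero: "\<zero> \<in> J"
    and add: "\<And>x y. x \<in> J \<Longrightarrow> y \<in> J \<Longrightarrow> x \<oplus> y \<in> J"
    and left: "\<And>x r. x \<in> J \<Longrightarrow> r \<in> carrier R \<Longrightarrow> r \<otimes> x \<in> J"
    and right: "\<And>x r. x \<in> J \<Longrightarrow> r \<in> carrier R \<Longrightarrow> x \<otimes> r \<in> J"
  shows "ideal J R"
proof (rule idealI[OF ring_axioms])
  show "subgroup J (add_monoid R)"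
  proof (rule add.subgroupI)
    fix x assume x: "x \<in> J"
    then have "\<ominus> x = \<ominus> \<one> \<otimes> x" using sub by (simp add: l_minus subsetD)
    then show "\<ominus> x \<in> J" using left[OF x] by simp
  qed (use assms in auto)
qed (use left right in auto)

text \<open>Letting \<open>r\<close> range over the whole ring absorbs right multiplication of
  \<open>x\<close>, which makes the set a two-sided ideal. It contains \<open>I\<close>, and it
  contains \<open>a\<close> exactly when \<open>a R b\<close> lies in \<open>I\<close>, so it can
  test primeness of \<open>I\<close> without computing with sums of ideals.\<close>

lemma ideal_left_transporter:
  assumes "ideal I R" "b \<in> carrier R"
  shows "ideal {x \<in> carrier R. \<forall>r \<in> carrier R. x \<otimes> r \<otimes> b \<in> I} R"
proof -
  interpret I: ideal I R by fact
  show ?thesis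
  proof (rule idealI_closed)
    fix x r assume x: "x \<in> {x \<in> carrier R. \<forall>r \<in> carrier R. x \<otimes> r \<otimes> b \<in> I}"
      and r: "r \<in> carrier R"
    have "r \<otimes> x \<otimes> s \<otimes> b \<in> I" if s: "s \<in> carrier R" for s
    proof -
      have "r \<otimes> x \<otimes> s \<otimes> b = r \<otimes> (x \<otimes> s \<otimes> b)"
        using x r s assms(2) by (simp add: m_assoc)
      then show ?thesis using x r s I.I_l_closed by simp
    qed
    then show "r \<otimes> x \<in> {x \<in> carrier R. \<forall>r \<in> carrier R. x \<otimes> r \<otimes> b \<in> I}"
      using x r by simp
    have "x \<otimes> r \<otimes> s \<otimes> b \<in> I" if s: "s \<in> carrier R" for s
    proof -
      have "x \<otimes> r \<otimes> s \<otimes> b = x \<otimes> (r \<otimes> s) \<otimes> b"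
        using x r s assms(2) by (simp add: m_assoc)
      then show ?thesis using x r s by simp
    qed
    then show "x \<otimes> r \<in> {x \<in> carrier R. \<forall>r \<in> carrier R. x \<otimes> r \<otimes> b \<in> I}"
      using x r by simp
  qed (use assms(2) in \<open>auto simp: l_distr I.a_closed\<close>)
qed

lemma ideal_right_transporter:
  assumes "ideal I R" "a \<in> carrier R"
  shows "ideal {y \<in> carrier R. \<forall>r \<in> carrier R. a \<otimes> r \<otimes> y \<in> I} R"
proof -
  interpret I: ideal I R by fact
  show ?thesis
  proof (rule idealI_closed)
    fix y r assume y: "y \<in> {y \<in> carrier R. \<forall>r \<in> carrier R. a \<otimes> r \<otimes> y \<in> I}"
      and r: "r \<in> carrier R"
    have "a \<otimes> s \<otimes> (r \<otimes> y) \<in> I" if s: "s \<in> carrier R" for s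
    proof -
      have "a \<otimes> s \<otimes> (r \<otimes> y) = a \<otimes> (s \<otimes> r) \<otimes> y"
        using y r s assms(2) by (simp add: m_assoc)
      then show ?thesis using y r s by simp
    qed
    then show "r \<otimes> y \<in> {y \<in> carrier R. \<forall>r \<in> carrier R. a \<otimes> r \<otimes> y \<in> I}"
      using y r by simp
    have "a \<otimes> s \<otimes> (y \<otimes> r) \<in> I" if s: "s \<in> carrier R" for s
    proof -
      have "a \<otimes> s \<otimes> (y \<otimes> r) = a \<otimes> s \<otimes> y \<otimes> r"
        using y r s assms(2) by (simp add: m_assoc)
      then show ?thesis using y r s I.I_r_closed by simp
    qed
    then show "y \<otimes> r \<in> {y \<in> carrier R. \<forall>r \<in> carrier R. a \<otimes> r \<otimes> y \<in> I}"
      using y r by simp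
  qed (use assms(2) in \<open>auto simp: r_distr I.a_closed\<close>)
qed

lemma ideal_Union_chain:
  assumes "\<And>I. I \<in> C \<Longrightarrow> ideal I R" "\<And>I J. I \<in> C \<Longrightarrow> J \<in> C \<Longrightarrow> I \<subseteq> J \<or> J \<subseteq> I" "C \<noteq> {}"
  shows "ideal (\<Union>C) R"
proof -
  have "subset.chain {I. ideal I R} C"
    using assms unfolding subset_chain_def by blast
  from chain_Union_is_ideal[OF this] show ?thesis using assms(3) by simp
qed

text \<open>An ideal maximal among those that contain \<open>I\<close> and avoid \<open>M\<close> is
  prime: were it not, passing to a left and then to a right transporter would put a product of two
  elements of \<open>M\<close> into it.\<close>

lemma exists_prime_disjoint:
  assumes I: "ideal I R" and M: "M \<subseteq> carrier R" "M \<noteq> {}"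
    and mult: "\<And>x y. x \<in> M \<Longrightarrow> y \<in> M \<Longrightarrow> x \<otimes> y \<in> M"
    and disj: "I \<inter> M = {}"
  obtains Q where "Q \<in> Spec R" "I \<subseteq> Q" "Q \<inter> M = {}"
proof -
  define F where "F = {J. ideal J R \<and> I \<subseteq> J \<and> J \<inter> M = {}}"
  have "\<exists>U\<in>F. \<forall>X\<in>K. X \<subseteq> U" if K: "subset.chain F K" for K
  proof (cases "K = {}")
    case True
    then show ?thesis using I disj unfolding F_def by blast
  next
    case False
    have mem: "ideal J R" "I \<subseteq> J" "J \<inter> M = {}" if "J \<in> K" for J
      using K that by (auto simp: F_def subset_chain_def)
    have "ideal (\<Union>K) R"
      using K False mem(1) by (intro ideal_Union_chain) (auto simp: subset_chain_def)
    moreover have "I \<subseteq> \<Union>K" using mem(2) False by auto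
    moreover have "\<Union>K \<inter> M = {}" using mem(3) by auto
    ultimately have "\<Union>K \<in> F" by (simp add: F_def)
    then show ?thesis by auto
  qed
  from subset_Zorn[of F, OF this]
  obtain Q where Q: "Q \<in> F" and max: "\<And>X. X \<in> F \<Longrightarrow> Q \<subseteq> X \<Longrightarrow> X = Q"
    by auto
  interpret Q: ideal Q R using Q unfolding F_def by blast
  \<comment> \<open>Maximality of \<open>Q\<close> in usable form: every strictly larger ideal meets
    \<open>M\<close>.\<close>
  have meets: "\<exists>m \<in> M. m \<in> J" if "ideal J R" "Q \<subseteq> J" "J \<noteq> Q" for J
    using max[of J] that Q unfolding F_def by blast
  have "a \<in> Q \<or> b \<in> Q"
    if a: "a \<in> carrier R" and b: "b \<in> carrier R"
      and ab: "{a \<otimes> r \<otimes> b | r. r \<in> carrier R} \<subseteq> Q" for a b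
  proof (rule ccontr)
    assume neg: "\<not> (a \<in> Q \<or> b \<in> Q)"
    \<comment> \<open>\<open>?A\<close> exceeds \<open>Q\<close> by \<open>a\<close>, so it yields
      an \<open>m\<close> in \<open>M\<close> with \<open>m R b\<close> inside \<open>Q\<close>:
      \<open>a\<close> has been traded for \<open>m\<close>.\<close>
    let ?A = "{x \<in> carrier R. \<forall>r \<in> carrier R. x \<otimes> r \<otimes> b \<in> Q}"
    have "Q \<subseteq> ?A" using b by (auto intro: Q.I_r_closed)
    moreover have "a \<in> ?A" using a ab by blast
    ultimately obtain m where m: "m \<in> M" "m \<in> ?A"
      using meets[OF ideal_left_transporter[OF Q.is_ideal b]] neg by blast
    \<comment> \<open>Symmetrically, \<open>?B\<close> exceeds \<open>Q\<close> by \<open>b\<close>,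
      which is traded for some \<open>n\<close> in \<open>M\<close>.\<close>
    let ?B = "{y \<in> carrier R. \<forall>r \<in> carrier R. m \<otimes> r \<otimes> y \<in> Q}"
    have mc: "m \<in> carrier R" using m M by blast
    then have "Q \<subseteq> ?B" by (auto intro: Q.I_l_closed)
    moreover have "b \<in> ?B" using m b by blast
    ultimately obtain n where n: "n \<in> M" "n \<in> ?B"
      using meets[OF ideal_right_transporter[OF Q.is_ideal mc]] neg by blast
    then have "m \<otimes> \<one> \<otimes> n \<in> Q" by blast
    then have "m \<otimes> n \<in> Q" using mc by simp
    then show False using mult[OF m(1) n(1)] Q unfolding F_def by blast
  qed
  moreover have "Q \<noteq> carrier R" using Q M unfolding F_def by blast
  ultimately have "Q \<in> Spec R" using Q.is_ideal unfolding Spec_def by blast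
  then show thesis using that Q unfolding F_def by blast
qed

end

section \<open>Contractions along a central homomorphism\<close>

lemma ideal_contraction:
  assumes "ring S" "f \<in> nonunital_ring_hom S R" "ideal I R"
  shows "ideal (contraction S f I) S"
proof -
  interpret S: ring S by fact
  interpret I: ideal I R by fact
  have f: "f x \<in> carrier R" if "x \<in> carrier S" for x
    using assms(2) that unfolding nonunital_ring_hom_def by blast
  have hom: "f (x \<oplus>\<^bsub>S\<^esub> y) = f x \<oplus>\<^bsub>R\<^esub> f y" "f (x \<otimes>\<^bsub>S\<^esub> y) = f x \<otimes>\<^bsub>R\<^esub> f y"
    if "x \<in> carrier S" "y \<in> carrier S" for x y
    using assms(2) that unfolding nonunital_ring_hom_def by blast+
  have "f \<zero>\<^bsub>S\<^esub> \<oplus>\<^bsub>R\<^esub> f \<zero>\<^bsub>S\<^esub> = f \<zero>\<^bsub>S\<^esub>"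
    using hom(1)[of "\<zero>\<^bsub>S\<^esub>" "\<zero>\<^bsub>S\<^esub>"] by simp
  then have zero: "f \<zero>\<^bsub>S\<^esub> = \<zero>\<^bsub>R\<^esub>"
    using f[of "\<zero>\<^bsub>S\<^esub>"] by simp
  show ?thesis
    unfolding contraction_def
    by (rule S.idealI_closed)
      (auto simp: zero hom f I.I_l_closed I.I_r_closed I.a_closed)
qed

text \<open>Centrality moves \<open>r\<close> out of \<open>f x r f y\<close>, leaving a left
  multiple of \<open>f x f y\<close>. Hence one product in \<open>Q\<close> already puts all of
  \<open>f x R f y\<close> into \<open>Q\<close>.\<close>

lemma contraction_completely_prime:
  assumes "ring R" "f \<in> nonunital_ring_hom S R" "f ` carrier S \<subseteq> ring_center R" "Q \<in> Spec R"
    and x: "x \<in> carrier S" and y: "y \<in> carrier S" and xy: "f x \<otimes>\<^bsub>R\<^esub> f y \<in> Q"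
  shows "f x \<in> Q \<or> f y \<in> Q"
proof -
  interpret R: ring R by fact
  interpret Q: ideal Q R using assms(4) unfolding Spec_def by blast
  have fx: "f x \<in> carrier R" and fy: "f y \<in> carrier R"
    using assms(2) x y unfolding nonunital_ring_hom_def by blast+
  have "f x \<otimes>\<^bsub>R\<^esub> r \<otimes>\<^bsub>R\<^esub> f y \<in> Q" if r: "r \<in> carrier R" for r
  proof -
    have "f x \<otimes>\<^bsub>R\<^esub> r = r \<otimes>\<^bsub>R\<^esub> f x"
      using assms(3) x r unfolding ring_center_def by blast
    then have "f x \<otimes>\<^bsub>R\<^esub> r \<otimes>\<^bsub>R\<^esub> f y = r \<otimes>\<^bsub>R\<^esub> (f x \<otimes>\<^bsub>R\<^esub> f y)"
      using fx fy r by (simp add: R.m_assoc)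
    then show ?thesis using Q.I_l_closed[OF xy r] by simp
  qed
  then have "{f x \<otimes>\<^bsub>R\<^esub> r \<otimes>\<^bsub>R\<^esub> f y | r. r \<in> carrier R} \<subseteq> Q" by blast
  then show ?thesis using assms(4) fx fy unfolding Spec_def by blast
qed

lemma GU_lift_over_chain:
  assumes "ring S" "ring R" and f: "f \<in> nonunital_ring_hom S R"
    and cen: "f ` carrier S \<subseteq> ring_center R" and GU: "GU S R f"
    and C: "subset.chain (Spec R) C" "C \<noteq> {}"
    and P: "P \<in> Spec S" and below: "\<And>Q. Q \<in> C \<Longrightarrow> contraction S f Q \<subseteq> P"
  obtains Q where "Q \<in> Spec R" "\<Union>C \<subseteq> Q" "lies_over S f Q P"
proof -
  interpret S: ring S by fact
  interpret R: ring R by fact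
  define P0 where "P0 = contraction S f (\<Union>C)"
  have P0: "P0 = f -` \<Union>C \<inter> carrier S" by (simp add: P0_def contraction_def)
  have CSpec: "C \<subseteq> Spec R" using C unfolding subset_chain_def by blast
  have U: "ideal (\<Union>C) R"
    using C unfolding subset_chain_def Spec_def by (intro R.ideal_Union_chain) auto
  have P0P: "P0 \<subseteq> P" using below unfolding P0_def contraction_def by blast
  have "P \<subseteq> carrier S" "P \<noteq> carrier S"
    using P unfolding Spec_def by (auto dest: ideal.Icarr)
  with P0P have proper: "P0 \<subset> carrier S" by blast
  have hom: "f (x \<otimes>\<^bsub>S\<^esub> y) = f x \<otimes>\<^bsub>R\<^esub> f y" if "x \<in> carrier S" "y \<in> carrier S" for x y
    using f that unfolding nonunital_ring_hom_def by blast
  \<comment> \<open>The image of a product in \<open>P0\<close> lies in a single member of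
    \<open>C\<close>, so complete primeness passes from that prime to the union.\<close>
  have cp: "x \<in> P0 \<or> y \<in> P0"
    if xy: "x \<in> carrier S" "y \<in> carrier S" "x \<otimes>\<^bsub>S\<^esub> y \<in> P0" for x y
  proof -
    obtain Q where "Q \<in> C" "f x \<otimes>\<^bsub>R\<^esub> f y \<in> Q" using xy hom unfolding P0 by auto
    then show ?thesis
      using contraction_completely_prime[OF assms(2) f cen _ xy(1,2)] CSpec xy(1,2)
      unfolding P0 by blast
  qed
  have "ideal P0 S" unfolding P0_def by (rule ideal_contraction[OF assms(1) f U])
  moreover have "x \<in> P0 \<or> y \<in> P0"
    if "x \<in> carrier S" "y \<in> carrier S" "{x \<otimes>\<^bsub>S\<^esub> r \<otimes>\<^bsub>S\<^esub> y | r. r \<in> carrier S} \<subseteq> P0" for x y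
  proof -
    have "x \<otimes>\<^bsub>S\<^esub> \<one>\<^bsub>S\<^esub> \<otimes>\<^bsub>S\<^esub> y \<in> P0" using that(3) by blast
    then show ?thesis using cp that(1,2) by simp
  qed
  ultimately have P0Spec: "P0 \<in> Spec S" using proper unfolding Spec_def by blast
  let ?M = "f ` (carrier S - P0)"
  have "f x \<otimes>\<^bsub>R\<^esub> f y \<in> ?M" if "x \<in> carrier S - P0" "y \<in> carrier S - P0" for x y
    using cp[of x y] hom[of x y] that by (intro image_eqI[of _ _ "x \<otimes>\<^bsub>S\<^esub> y"]) auto
  then have mult: "u \<otimes>\<^bsub>R\<^esub> v \<in> ?M" if "u \<in> ?M" "v \<in> ?M" for u v
    using that by blast
  have "?M \<subseteq> carrier R" using f unfolding nonunital_ring_hom_def by blast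
  moreover have "?M \<noteq> {}" using proper by blast
  moreover have "\<Union>C \<inter> ?M = {}" unfolding P0 by blast
  ultimately obtain Q0 where Q0: "Q0 \<in> Spec R" "\<Union>C \<subseteq> Q0" "Q0 \<inter> ?M = {}"
    using R.exists_prime_disjoint[OF U _ _ mult] by blast
  \<comment> \<open>Containing \<open>\<Union>C\<close> gives one inclusion; avoiding the images of
    elements outside \<open>P0\<close> gives the other.\<close>
  have over: "lies_over S f Q0 P0"
    using Q0 unfolding lies_over_def contraction_def P0 by blast
  show thesis
  \<comment> \<open>GU concerns proper inclusions only; if \<open>P0 = P\<close>, then
    \<open>Q0\<close> itself lies over \<open>P\<close>.\<close>
  proof (cases "P0 = P")
    case True
    then show thesis using that Q0 over by blast
  next
    case False
    with P0P have "P0 \<subset> P" by blast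
    from GU[unfolded GU_def, rule_format, OF P0Spec P this Q0(1) over]
    obtain Q where "Q \<in> Spec R" "Q0 \<subset> Q" "lies_over S f Q P" by auto
    then show thesis using that[of Q] Q0(2) by auto
  qed
qed

section \<open>GU and maximal chains over a chain of primes\<close>

text \<open>Moving the condition on contractions into the ambient set makes
  \<open>subset_maxchain_extends\<close> applicable.\<close>

lemma maximal_D_chain_iff_maxchain:
  "maximal_D_chain S R f D C \<longleftrightarrow> subset.maxchain {Q \<in> Spec R. contraction S f Q \<in> D} C"
proof -
  have "D_chain S R f D B \<longleftrightarrow> subset.chain {Q \<in> Spec R. contraction S f Q \<in> D} B" for B
    by (auto simp: D_chain_def subset_chain_def)
  then show ?thesis by (simp add: maximal_D_chain_def subset.maxchain_def)
qed

theorem proposition2p6: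
  fixes S :: "('a, 'm) ring_scheme"
    and R :: "('b, 'n) ring_scheme"
    and f :: "'a \<Rightarrow> 'b"
  assumes "nontrivial_ring S"
    and "nontrivial_ring R"
    and "f \<in> nonunital_ring_hom S R"
    and "f ` carrier S \<subseteq> ring_center R"
  shows "GU S R f \<longleftrightarrow>
    (\<forall>D C. subset.chain (Spec S) D \<and> D \<noteq> {} \<and> maximal_D_chain S R f D C \<and> C \<noteq> {} \<longrightarrow>
       (\<forall>P \<in> D. \<exists>Q \<in> C. P \<subseteq> contraction S f Q))"
proof -
  interpret S: nontrivial_ring S by fact
  interpret R: nontrivial_ring R by fact
  show ?thesis
  proof (intro iffI allI impI ballI)
    fix D C P
    assume GU: "GU S R f"
      and DC: "subset.chain (Spec S) D \<and> D \<noteq> {} \<and> maximal_D_chain S R f D C \<and> C \<noteq> {}"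
      and P: "P \<in> D"
    have C: "subset.chain (Spec R) C" "C \<noteq> {}" "\<And>Q. Q \<in> C \<Longrightarrow> contraction S f Q \<in> D"
      and max: "\<And>C'. D_chain S R f D C' \<Longrightarrow> \<not> C \<subset> C'"
      using DC by (auto simp: maximal_D_chain_def D_chain_def)
    show "\<exists>Q \<in> C. P \<subseteq> contraction S f Q"
    proof (rule ccontr)
      assume neg: "\<not> ?thesis"
      have D: "D \<subseteq> Spec S" "\<And>X Y. X \<in> D \<Longrightarrow> Y \<in> D \<Longrightarrow> X \<subseteq> Y \<or> Y \<subseteq> X"
        using DC by (auto simp: subset_chain_def)
      have below: "contraction S f Q \<subseteq> P" if "Q \<in> C" for Q
        using neg that D(2)[OF P C(3)[OF that]] by auto
      obtain Q where Q: "Q \<in> Spec R" "\<Union>C \<subseteq> Q" "lies_over S f Q P"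
        using GU_lift_over_chain[OF S.ring_axioms R.ring_axioms assms(3,4) GU C(1,2)
            subsetD[OF D(1) P] below] .
      have "Q \<notin> C" using neg Q(3) unfolding lies_over_def by auto
      \<comment> \<open>\<open>Q\<close> contains \<open>\<Union>C\<close>, hence is comparable with
        every member of \<open>C\<close>, and its contraction \<open>P\<close> belongs to
        \<open>D\<close>.\<close>
      moreover have "D_chain S R f D (insert Q C)"
        using C Q P by (auto simp: D_chain_def subset_chain_insert lies_over_def)
      ultimately show False using max[of "insert Q C"] by auto
    qed
  next
    assume H: "\<forall>D C. subset.chain (Spec S) D \<and> D \<noteq> {} \<and> maximal_D_chain S R f D C \<and> C \<noteq> {} \<longrightarrow>
       (\<forall>P \<in> D. \<exists>Q \<in> C. P \<subseteq> contraction S f Q)"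
    show "GU S R f"
      unfolding GU_def
    proof (intro ballI impI)
      fix P1 P2 Q1
      assume P: "P1 \<in> Spec S" "P2 \<in> Spec S" "P1 \<subset> P2"
        and Q1: "Q1 \<in> Spec R" "lies_over S f Q1 P1"
      let ?D = "{P1, P2}"
      have "subset.chain {Q \<in> Spec R. contraction S f Q \<in> ?D} {Q1}"
        using Q1 by (simp add: subset_chain_def lies_over_def)
      from subset_maxchain_extends[OF this]
      obtain C where C: "maximal_D_chain S R f ?D C" "Q1 \<in> C"
        by (auto simp: maximal_D_chain_iff_maxchain)
      have "subset.chain (Spec S) ?D" using P by (auto simp: subset_chain_def)
      then have "\<exists>Q \<in> C. P2 \<subseteq> contraction S f Q"
        by (intro H[rule_format, of ?D C P2]) (use C in auto)
      then obtain Q where Q: "Q \<in> C" "P2 \<subseteq> contraction S f Q" ..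
      have C_D: "C \<subseteq> Spec R" "\<And>Q. Q \<in> C \<Longrightarrow> contraction S f Q \<in> ?D"
        and C_chain: "\<And>X Y. X \<in> C \<Longrightarrow> Y \<in> C \<Longrightarrow> X \<subseteq> Y \<or> Y \<subseteq> X"
        using C(1) by (auto simp: maximal_D_chain_def D_chain_def subset_chain_def)
      \<comment> \<open>The only other possible contraction is \<open>P1\<close>, which is too small
        to contain \<open>P2\<close>.\<close>
      have over: "contraction S f Q = P2" using C_D(2)[OF Q(1)] Q(2) P(3) by auto
      \<comment> \<open>Contraction is monotone, so \<open>Q \<subseteq> Q1\<close> would force
        \<open>P2 \<subseteq> P1\<close>.\<close>
      then have "\<not> Q \<subseteq> Q1"
        using Q1(2) P(3) by (auto simp: lies_over_def contraction_def)
      with C_chain[OF Q(1) C(2)] have "Q1 \<subset> Q" by auto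
      moreover have "Q \<in> Spec R" using C_D(1) Q(1) by auto
      ultimately show "\<exists>Q2 \<in> Spec R. Q1 \<subset> Q2 \<and> lies_over S f Q2 P2"
        using over by (auto simp: lies_over_def)
    qed
  qed
qed

end
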